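(* Let $n \geq 1$ be an integer, let $\mu_1,\ldots,\mu_n$ be real numbers with $\mu_k>0$ for $k=1,\ldots,n$ and $\rho=\sum_{k=1}^{n}\mu_k\leq 1$, and let $c_1>c_2>\cdots>c_n>0$ be real numbers. Assume that either $n\geq 2$, or $n=1$ and $\mu_1<1$. Define the real numbers $D_j$, $j\geq 1$, by the power series expansion about $t=0$ $$\prod_{j=1}^{n}(1-c_jt)^{\mu_j}=1-\sum_{j=1}^{\infty}D_jt^j .$$ Then $D_j>0$ for every $j=1,2,\ldots$.
   Context: Here $(1-ct)^{\mu}$, for real $c>0$ and $\mu>0$, denotes the binomial power series $\sum_{k\ge 0}\binom{\mu}{k}(-c)^k t^k$ about $t=0$ (the principal branch, equal to $1$ at $t=0$), and the product is the product of these power series. *)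

theory Defs
  imports "HOL-Computational_Algebra.Formal_Power_Series"
begin

definition binomial_fps :: "real \<Rightarrow> real \<Rightarrow> real fps" where
  "binomial_fps \<mu> c = Abs_fps (\<lambda>k. (\<mu> gchoose k) * (- c) ^ k)"

end

theory Submission
  imports Defs
begin

unbundle fps_syntax

text \<open>
  The two operations \<open>F \<mapsto> F\<^sup>\<rho>\<close> for \<open>0 < \<rho> \<le> 1\<close> and
  \<open>F(t) \<mapsto> (1 - at) F(t/(1 - at))\<close> for \<open>a \<ge> 0\<close> preserve the class of series
  \<open>F = 1 - \<Sum>e\<^sub>jt\<^sup>j\<close> with all \<open>e\<^sub>j \<ge> 0\<close>. If \<open>\<Sum>\<mu>\<^sub>k = 1\<close> and \<open>a\<close> is the least of the \<open>c\<^sub>k\<close>, then the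
  second operation sends \<open>\<Prod>(1 - (c\<^sub>k - a)t)\<^bsup>\<mu>\<^sub>k\<^esup>\<close> to \<open>\<Prod>(1 - c\<^sub>kt)\<^bsup>\<mu>\<^sub>k\<^esup>\<close>. The former product
  has one nontrivial factor less, and it is the power \<open>\<rho> < 1\<close> (the sum of the remaining
  exponents) of a product whose exponents again sum to 1, so induction applies. Raising to a
  power \<open>\<rho> < 1\<close> makes every \<open>e\<^sub>j\<close> strictly positive as soon as \<open>e\<^sub>1 > 0\<close>.
\<close>

section \<open>Logarithmic derivatives and powers of formal power series\<close>

definition fps_logderiv :: "'a::field fps \<Rightarrow> 'a fps" where
  "fps_logderiv F = fps_deriv F * inverse F"

lemma fps_logderiv_1 [simp]: "fps_logderiv 1 = 0"
  by (simp add: fps_logderiv_def)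

lemma fps_logderiv_mult:
  assumes "F $ 0 \<noteq> 0" "G $ 0 \<noteq> 0"
  shows "fps_logderiv (F * G) = fps_logderiv F + fps_logderiv G"
proof -
  have "F * inverse F = 1" "G * inverse G = 1"
    using assms by (simp_all add: inverse_mult_eq_1')
  then show ?thesis
    unfolding fps_logderiv_def fps_inverse_mult fps_deriv_mult by algebra
qed

lemma fps_prod_nth_0: "(\<Prod>i\<in>S. F i) $ 0 = (\<Prod>i\<in>S. (F i :: 'a::comm_ring_1 fps) $ 0)"
  by (induction S rule: infinite_finite_induct) simp_all

lemma fps_logderiv_prod:
  assumes "\<And>i. i \<in> S \<Longrightarrow> F i $ 0 = 1"
  shows "fps_logderiv (\<Prod>i\<in>S. F i) = (\<Sum>i\<in>S. fps_logderiv (F i))"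
  using assms
proof (induction S rule: infinite_finite_induct)
  case (insert i S)
  have "(\<Prod>i\<in>S. F i) $ 0 = 1"
    using insert.prems by (simp add: fps_prod_nth_0)
  with insert show ?case by (simp add: fps_logderiv_mult)
qed simp_all

lemma fps_logderiv_compose:
  assumes "u $ 0 = 0" "F $ 0 \<noteq> 0"
  shows "fps_logderiv (F oo u) = (fps_logderiv F oo u) * fps_deriv u"
  unfolding fps_logderiv_def
  by (simp add: fps_compose_deriv fps_compose_mult_distrib fps_inverse_compose assms)

text \<open>The quotient \<open>F * inverse G\<close> has zero derivative, so it is the constant 1.
  Identities between products of powers thereby become linear identities between logarithmic
  derivatives.\<close>

lemma fps_logderiv_inj:
  fixes F G :: "'a::field_char_0 fps"
  assumes "fps_logderiv F = fps_logderiv G" "F $ 0 = 1" "G $ 0 = 1"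
  shows "F = G"
proof -
  have inv: "F * inverse F = 1" "G * inverse G = 1"
    using assms by (simp_all add: inverse_mult_eq_1')
  have G: "G $ 0 \<noteq> 0" using assms(3) by simp
  have "fps_deriv (F * inverse G) = 0"
  proof -
    have "fps_deriv (F * inverse G) = F * inverse G * (fps_logderiv F - fps_logderiv G)"
      unfolding fps_logderiv_def fps_deriv_mult fps_inverse_deriv[OF G]
      using inv by algebra
    then show ?thesis using assms(1) by simp
  qed
  then have "F * inverse G = 1"
    using assms unfolding fps_deriv_eq_0_iff by simp
  then show ?thesis using inv(2) by algebra
qed

text \<open>Meant for \<open>F $ 0 = 1\<close>. The expansion in powers of \<open>F - 1\<close>
  exposes the binomial coefficients, whose signs are exploited later.\<close>

definition fps_powr :: "'a::field_char_0 fps \<Rightarrow> 'a \<Rightarrow> 'a fps" where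
  "fps_powr F a = fps_binomial a oo (F - 1)"

lemma fps_powr_nth_0 [simp]: "fps_powr F a $ 0 = 1"
  by (simp add: fps_powr_def)

lemma fps_logderiv_binomial:
  "fps_logderiv (fps_binomial a) = fps_const a * inverse (1 + fps_X)"
proof -
  have "fps_binomial a * inverse (fps_binomial a) = 1"
    by (simp add: inverse_mult_eq_1')
  moreover have "fps_deriv (fps_binomial a) = fps_const a * fps_binomial a * inverse (1 + fps_X)"
    by (simp add: fps_binomial_deriv fps_divide_unit)
  ultimately show ?thesis unfolding fps_logderiv_def by algebra
qed

lemma fps_logderiv_powr:
  assumes "F $ 0 = 1"
  shows "fps_logderiv (fps_powr F a) = fps_const a * fps_logderiv F"
proof -
  have F: "(F - 1) $ 0 = 0" using assms by simp
  have "(1 + fps_X) oo (F - 1) = F"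
    using F by (simp add: fps_compose_add_distrib)
  then have "inverse (1 + fps_X) oo (F - 1) = inverse F"
    using F by (simp add: fps_inverse_compose)
  then show ?thesis
    unfolding fps_powr_def
    by (simp add: fps_logderiv_compose[OF F] fps_logderiv_binomial fps_compose_mult_distrib[OF F])
       (simp add: fps_logderiv_def mult_ac)
qed

lemma binomial_fps_eq_compose:
  "binomial_fps m c = fps_binomial m oo (fps_const (- c) * fps_X)"
  unfolding fps_compose_linear by (simp add: binomial_fps_def mult.commute)

lemma binomial_fps_nth_0 [simp]: "binomial_fps m c $ 0 = 1"
  by (simp add: binomial_fps_def)

lemma binomial_fps_0 [simp]: "binomial_fps m 0 = 1"
  by (simp add: fps_eq_iff binomial_fps_def power_0_left)

lemma binomial_fps_0_left [simp]: "binomial_fps 0 c = 1"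
  by (simp add: binomial_fps_eq_compose)

lemma binomial_fps_add: "binomial_fps (m + m') c = binomial_fps m c * binomial_fps m' c"
  by (simp add: binomial_fps_eq_compose fps_binomial_add_mult fps_compose_mult_distrib)

lemma binomial_fps_1: "binomial_fps 1 c = 1 - fps_const c * fps_X"
  unfolding binomial_fps_eq_compose fps_binomial_1[where 'a = real]
  by (simp add: fps_compose_add_distrib flip: fps_const_neg)

lemma fps_logderiv_binomial_fps:
  "fps_logderiv (binomial_fps m c) = - fps_const (m * c) * inverse (1 - fps_const c * fps_X)"
proof -
  define u where "u = fps_const (- c) * (fps_X :: real fps)"
  have u: "u $ 0 = 0" by (simp add: u_def)
  have "(1 + fps_X) oo u = 1 - fps_const c * fps_X"
    using u by (simp add: fps_compose_add_distrib u_def flip: fps_const_neg)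
  then have "inverse (1 + fps_X) oo u = inverse (1 - fps_const c * fps_X)"
    using u by (simp add: fps_inverse_compose)
  moreover have "fps_deriv u = fps_const (- c)"
    by (simp add: u_def)
  ultimately show ?thesis
    unfolding binomial_fps_eq_compose u_def[symmetric]
    by (simp add: fps_logderiv_compose[OF u] fps_logderiv_binomial fps_compose_mult_distrib[OF u]
        mult_ac flip: fps_const_mult fps_const_neg)
qed

text \<open>Lets exponents be rescaled to sum 1. On both sides each factor contributes -a m c/(1 -
  ct) to the logarithmic derivative.\<close>

lemma fps_powr_prod_binomial_fps:
  "fps_powr (\<Prod>i\<in>S. binomial_fps (m i) (c i)) a = (\<Prod>i\<in>S. binomial_fps (a * m i) (c i))"
proof (rule fps_logderiv_inj)
  have "(\<Prod>i\<in>S. binomial_fps (m i) (c i)) $ 0 = 1"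
    by (simp add: fps_prod_nth_0)
  then show "fps_logderiv (fps_powr (\<Prod>i\<in>S. binomial_fps (m i) (c i)) a)
      = fps_logderiv (\<Prod>i\<in>S. binomial_fps (a * m i) (c i))"
    by (simp add: fps_logderiv_powr fps_logderiv_prod fps_logderiv_binomial_fps sum_distrib_left
        mult.assoc flip: fps_const_mult fps_const_neg)
qed (simp_all add: fps_prod_nth_0)

section \<open>The substitution \<open>t \<mapsto> t / (1 - at)\<close>\<close>

definition fps_geom :: "real \<Rightarrow> real fps" where
  "fps_geom a = Abs_fps (\<lambda>n. a ^ n)"

lemma fps_geom_nth [simp]: "fps_geom a $ n = a ^ n"
  by (simp add: fps_geom_def)

lemma fps_geom_mult: "(1 - fps_const a * fps_X) * fps_geom a = 1"
proof (rule fps_ext)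
  fix n show "((1 - fps_const a * fps_X) * fps_geom a) $ n = 1 $ n"
    by (cases n) (simp_all add: left_diff_distrib mult.assoc)
qed

lemma inverse_one_minus_fps_X: "inverse (1 - fps_const a * fps_X) = fps_geom a"
  by (rule fps_inverse_unique) (rule fps_geom_mult)

lemma fps_deriv_geom: "fps_deriv (fps_X * fps_geom a) = fps_geom a * fps_geom a"
proof -
  have "fps_deriv (fps_geom a) = fps_const a * (fps_geom a)\<^sup>2"
    unfolding inverse_one_minus_fps_X[symmetric]
    by (subst fps_inverse_deriv) (simp_all add: flip: fps_const_neg)
  then show ?thesis
    using fps_geom_mult[of a] by (simp add: power2_eq_square) algebra
qed

text \<open>This is the m-th power of (1 - at)(1 - dt/(1 - at)) = 1 - (d + a)t.\<close>

lemma binomial_fps_moebius: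
  "binomial_fps m a * (binomial_fps m d oo (fps_X * fps_geom a)) = binomial_fps m (d + a)"
proof (rule fps_logderiv_inj)
  define u where "u = fps_X * fps_geom a"
  have u: "u $ 0 = 0" by (simp add: u_def)
  have du: "fps_deriv u = fps_geom a * fps_geom a"
    unfolding u_def by (rule fps_deriv_geom)
  define W where "W = fps_geom (d + a)"
  have W: "(1 - fps_const (d + a) * fps_X) * W = 1"
    unfolding W_def by (rule fps_geom_mult)
  have "(1 - fps_const d * fps_X) oo u = 1 - fps_const d * u"
    using u by (simp add: fps_compose_sub_distrib fps_compose_mult_distrib)
  \<comment> \<open>Here 1 - du = (1 - (d + a)t)/(1 - at).\<close>
  moreover have "(1 - fps_const d * u) * (W * (1 - fps_const a * fps_X)) = 1"
    using W fps_geom_mult[of a] unfolding u_def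
    by (simp flip: fps_const_add) algebra
  ultimately have inv: "fps_geom d oo u = W * (1 - fps_const a * fps_X)"
    unfolding inverse_one_minus_fps_X[symmetric]
    by (simp add: fps_inverse_compose u fps_inverse_unique)
  have "fps_logderiv (binomial_fps m a * (binomial_fps m d oo u)) =
     - fps_const (m * a) * fps_geom a
     - fps_const (m * d) * (W * (1 - fps_const a * fps_X)) * (fps_geom a * fps_geom a)"
    by (simp add: fps_logderiv_mult fps_logderiv_compose u fps_logderiv_binomial_fps
        inverse_one_minus_fps_X fps_compose_mult_distrib fps_compose_uminus inv
        du del: fps_const_neg fps_const_mult)
  \<comment> \<open>Cleared of denominators: a(1 - (d + a)t) + d = (d + a)(1 - at).\<close>
  also have "\<dots> = - fps_const (m * (d + a)) * W"
    using W fps_geom_mult[of a]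
    by (simp flip: fps_const_add fps_const_mult fps_const_neg) algebra
  finally show "fps_logderiv (binomial_fps m a * (binomial_fps m d oo (fps_X * fps_geom a)))
      = fps_logderiv (binomial_fps m (d + a))"
    by (simp add: fps_logderiv_binomial_fps inverse_one_minus_fps_X W_def u_def)
qed simp_all

lemma prod_binomial_fps_same:
  "(\<Prod>i\<in>S. binomial_fps (m i) a) = binomial_fps (\<Sum>i\<in>S. m i) a"
  by (induction S rule: infinite_finite_induct) (simp_all add: binomial_fps_add)

text \<open>Exponent sum 1 collapses the factors (1 - at)^(m i) into the polynomial 1 - at.\<close>

lemma prod_binomial_fps_moebius:
  assumes "(\<Sum>i\<in>S. m i) = 1"
  shows "(1 - fps_const a * fps_X) *
           ((\<Prod>i\<in>S. binomial_fps (m i) (c i - a)) oo (fps_X * fps_geom a))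
         = (\<Prod>i\<in>S. binomial_fps (m i) (c i))"
proof -
  have "(\<Prod>i\<in>S. binomial_fps (m i) (c i)) =
        (\<Prod>i\<in>S. binomial_fps (m i) a * (binomial_fps (m i) (c i - a) oo (fps_X * fps_geom a)))"
    by (simp add: binomial_fps_moebius)
  then show ?thesis
    by (simp add: prod.distrib prod_binomial_fps_same assms binomial_fps_1 fps_compose_prod_distrib)
qed

section \<open>Sign patterns preserved by powers and by the substitution\<close>

lemma fps_mult_nonneg:
  fixes F G :: "'a::linordered_idom fps"
  assumes "\<And>k. F $ k \<ge> 0" "\<And>k. G $ k \<ge> 0"
  shows "(F * G) $ k \<ge> 0"
  by (simp add: fps_mult_nth sum_nonneg assms)

lemma fps_power_nonneg:
  fixes F :: "'a::linordered_idom fps"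
  assumes "\<And>k. F $ k \<ge> 0"
  shows "(F ^ i) $ k \<ge> 0"
  by (induction i arbitrary: k) (simp_all add: fps_mult_nonneg assms)

text \<open>As \<open>u\<close> starts with t, the summand \<open>i = k\<close> of the composition
  is exactly \<open>G $ k\<close>; the other summands are nonnegative.\<close>

lemma fps_compose_nth_ge:
  fixes G u :: "'a::linordered_idom fps"
  assumes "\<And>k. G $ k \<ge> 0" "\<And>k. u $ k \<ge> 0" "u $ 0 = 0" "u $ 1 = 1"
  shows "(G oo u) $ k \<ge> G $ k"
proof -
  have "G $ k * (u ^ k) $ k \<le> (\<Sum>i\<in>{0..k}. G $ i * (u ^ i) $ k)"
    by (rule member_le_sum) (auto intro!: mult_nonneg_nonneg assms fps_power_nonneg)
  then show ?thesis
    using assms(3,4) by (simp add: fps_compose_nth startsby_zero_power_nth_same)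
qed

text \<open>Write F = 1 - tG with G nonnegative. The factor 1 - at cancels the denominator of the
  substituted t, leaving 1 - at - t(G o u), and G o u dominates G.\<close>

lemma moebius_nth_le:
  fixes F :: "real fps"
  assumes "F $ 0 = 1" "\<And>k. k \<ge> 1 \<Longrightarrow> F $ k \<le> 0" "a \<ge> 0" "k \<ge> 1"
  shows "((1 - fps_const a * fps_X) * (F oo (fps_X * fps_geom a))) $ k \<le> F $ k"
proof -
  define u where "u = fps_X * fps_geom a"
  have u: "u $ 0 = 0" by (simp add: u_def)
  define G where "G = - fps_shift 1 F"
  have F: "F = 1 - fps_X * G"
    using assms(1) by (intro fps_ext) (simp add: G_def fps_eq_iff)
  have "(1 - fps_const a * fps_X) * (F oo u)
      = 1 - fps_const a * fps_X - ((1 - fps_const a * fps_X) * fps_geom a) * fps_X * (G oo u)"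
    by (subst F) (simp add: fps_compose_sub_distrib fps_compose_mult_distrib u u_def algebra_simps)
  then have eq: "(1 - fps_const a * fps_X) * (F oo u) = 1 - fps_const a * fps_X - fps_X * (G oo u)"
    by (simp add: fps_geom_mult)
  have "G $ (k - 1) \<le> (G oo u) $ (k - 1)"
    using assms by (intro fps_compose_nth_ge) (auto simp: G_def u_def)
  moreover have "G $ (k - 1) = - F $ k"
    using assms(4) by (simp add: G_def)
  ultimately show ?thesis
    using assms(3,4) unfolding u_def[symmetric] eq by auto
qed

text \<open>The first term is -r, and consecutive terms have the ratio (k - r)/(k + 1), positive for
  k >= 1 > r.\<close>

lemma gbinomial_alternating_neg:
  fixes r :: real
  assumes "0 < r" "r < 1" "k \<ge> 1"
  shows "(r gchoose k) * (- 1) ^ k < 0"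
  using assms(3)
proof (induction k rule: dec_induct)
  case base
  then show ?case using assms by simp
next
  case (step k)
  have "(r gchoose Suc k) * (- 1) ^ Suc k
      = ((r gchoose k) * (- 1) ^ k) * ((real k - r) / real (Suc k))"
  proof -
    have "(r gchoose Suc k) = (r gchoose k) * ((r - real k) / real (Suc k))"
      using gbinomial_mult_1[of r k] by (simp add: field_simps)
    then have "(r gchoose Suc k) * (- 1) ^ Suc k
        = (r gchoose k) * ((r - real k) / real (Suc k)) * (- 1) ^ Suc k"
      by (rule arg_cong)
    also have "\<dots> = ((r gchoose k) * (- 1) ^ k) * (- ((r - real k) / real (Suc k)))"
      by (simp only: power_Suc mult_ac mult_minus_left mult_minus_right mult_1_left)
    finally show ?thesis by (simp only: minus_divide_left minus_diff_eq)
  qed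
  moreover have "(real k - r) / real (Suc k) > 0"
    using step.hyps assms by simp
  ultimately show ?case
    using step.IH by (simp only: mult_neg_pos)
qed

text \<open>With E = 1 - F, every term of the binomial expansion in E is nonpositive in degree
  \<open>k\<close>. Strictness comes from the term \<open>i = k\<close>, where \<open>E ^ k\<close>
  contributes the k-th power of \<open>E $ 1\<close>.\<close>

lemma fps_powr_nth_sign:
  fixes F :: "real fps"
  assumes "F $ 0 = 1" "\<And>k. k \<ge> 1 \<Longrightarrow> F $ k \<le> 0" "0 < r" "r < 1" "k \<ge> 1"
  shows "fps_powr F r $ k \<le> 0" and "F $ 1 < 0 \<Longrightarrow> fps_powr F r $ k < 0"
proof -
  define E where "E = 1 - F"
  have E0: "E $ 0 = 0" and E: "E $ j \<ge> 0" for j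
    using assms by (cases j; simp add: E_def)+
  have "F - 1 = fps_const (- 1) * E"
    by (simp add: E_def flip: fps_const_neg)
  then have nth: "fps_powr F r $ k = (\<Sum>i\<in>{0..k}. (r gchoose i) * (- 1) ^ i * (E ^ i) $ k)"
    by (simp add: fps_powr_def fps_compose_nth power_mult_distrib fps_const_power mult.assoc
        del: fps_const_neg)
  have nonpos: "(r gchoose i) * (- 1) ^ i * (E ^ i) $ k \<le> 0" for i
  \<comment> \<open>The term \<open>i = 0\<close> is the constant 1, invisible in degree
    \<open>k >= 1\<close>.\<close>
  proof (cases "i = 0")
    case False
    then have "(r gchoose i) * (- 1) ^ i < 0"
      using gbinomial_alternating_neg assms(3,4) by simp
    then show ?thesis
      by (simp only: mult_nonpos_nonneg fps_power_nonneg[OF E] less_imp_le)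
  qed (use assms(5) in simp)
  then show "fps_powr F r $ k \<le> 0"
    unfolding nth by (intro sum_nonpos)
  assume "F $ 1 < 0"
  then have "(E ^ k) $ k > 0"
    by (simp add: startsby_zero_power_nth_same E0) (simp add: E_def)
  then have "(r gchoose k) * (- 1) ^ k * (E ^ k) $ k < 0"
    using gbinomial_alternating_neg[OF assms(3-5)] by (simp only: mult_neg_pos)
  then have "(\<Sum>i\<in>{0..k}. (r gchoose i) * (- 1) ^ i * (E ^ i) $ k) < (\<Sum>i\<in>{0..k}. 0)"
    using nonpos by (intro sum_strict_mono_ex1) auto
  then show "fps_powr F r $ k < 0"
    by (simp add: nth)
qed

section \<open>Products of binomial series\<close>

lemma prod_binomial_fps_nth_1:
  "(\<Prod>i\<in>S. binomial_fps (m i) (c i)) $ 1 = - (\<Sum>i\<in>S. m i * c i)"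
proof (induction S rule: infinite_finite_induct)
  case (insert i S)
  then show ?case
    by (simp add: fps_mult_nth_1 fps_prod_nth_0) (simp add: binomial_fps_def)
qed simp_all

text \<open>The product is the r-th power of one with exponents \<open>m i / r\<close>, which sum to
  1; hence \<open>nonpos\<close> ranges over all \<open>m\<close>. Keeping it as a hypothesis lets
  an induction hypothesis supply it.\<close>

lemma prod_binomial_fps_sum_less_1:
  fixes m c :: "'a \<Rightarrow> real"
  assumes nonpos: "\<And>m j. (\<And>i. i \<in> S \<Longrightarrow> m i > 0) \<Longrightarrow> (\<Sum>i\<in>S. m i) = 1 \<Longrightarrow> j \<ge> 1 \<Longrightarrow>
      (\<Prod>i\<in>S. binomial_fps (m i) (c i)) $ j \<le> 0"
    and S: "finite S" "S \<noteq> {}"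
    and m: "\<And>i. i \<in> S \<Longrightarrow> m i > 0" "(\<Sum>i\<in>S. m i) < 1"
    and c: "\<And>i. i \<in> S \<Longrightarrow> c i \<ge> 0"
    and k: "k \<ge> 1"
  shows "(\<Prod>i\<in>S. binomial_fps (m i) (c i)) $ k \<le> 0"
    and "i \<in> S \<Longrightarrow> c i > 0 \<Longrightarrow> (\<Prod>i\<in>S. binomial_fps (m i) (c i)) $ k < 0"
proof -
  define r where "r = (\<Sum>i\<in>S. m i)"
  have r: "0 < r" "r < 1"
    using m S by (auto simp: r_def intro: sum_pos)
  define F where "F = (\<Prod>i\<in>S. binomial_fps (m i / r) (c i))"
  have powr: "(\<Prod>i\<in>S. binomial_fps (m i) (c i)) = fps_powr F r"
    using r by (simp add: F_def fps_powr_prod_binomial_fps)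
  have F0: "F $ 0 = 1"
    by (simp add: F_def fps_prod_nth_0)
  have F: "F $ j \<le> 0" if "j \<ge> 1" for j
    unfolding F_def using r m that
    by (intro nonpos) (simp_all add: r_def[symmetric] flip: sum_divide_distrib)
  show "(\<Prod>i\<in>S. binomial_fps (m i) (c i)) $ k \<le> 0"
    unfolding powr using F0 F r k by (rule fps_powr_nth_sign)
  assume "i \<in> S" "c i > 0"
  then have "(\<Sum>i\<in>S. m i / r * c i) > 0"
    using r m(1) c S
    by (intro sum_pos2[of S i] mult_nonneg_nonneg divide_nonneg_nonneg mult_pos_pos divide_pos_pos)
       (auto simp: less_imp_le)
  then have "F $ 1 < 0"
    unfolding F_def prod_binomial_fps_nth_1 by simp
  with F0 F r k show "(\<Prod>i\<in>S. binomial_fps (m i) (c i)) $ k < 0"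
    unfolding powr by (rule fps_powr_nth_sign)
qed

lemma prod_binomial_fps_shift_min:
  fixes m c :: "'a \<Rightarrow> real"
  assumes S: "finite S" "p \<in> S" and c: "c p \<ge> 0"
    and m: "(\<Sum>i\<in>S. m i) = 1"
    and nonpos: "\<And>j. j \<ge> 1 \<Longrightarrow> (\<Prod>i\<in>S - {p}. binomial_fps (m i) (c i - c p)) $ j \<le> 0"
    and k: "k \<ge> 1"
  shows "(\<Prod>i\<in>S. binomial_fps (m i) (c i)) $ k
           \<le> (\<Prod>i\<in>S - {p}. binomial_fps (m i) (c i - c p)) $ k"
proof -
  define F where "F = (\<Prod>i\<in>S - {p}. binomial_fps (m i) (c i - c p))"
  have "F = (\<Prod>i\<in>S. binomial_fps (m i) (c i - c p))"
    unfolding F_def by (simp add: prod.remove[OF S])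
  then have "(\<Prod>i\<in>S. binomial_fps (m i) (c i))
      = (1 - fps_const (c p) * fps_X) * (F oo (fps_X * fps_geom (c p)))"
    using prod_binomial_fps_moebius[OF m, of "c p" c] by simp
  moreover have "((1 - fps_const (c p) * fps_X) * (F oo (fps_X * fps_geom (c p)))) $ k \<le> F $ k"
    using nonpos c k by (intro moebius_nth_le) (simp_all add: F_def fps_prod_nth_0)
  ultimately show ?thesis
    by (simp add: F_def)
qed

lemma prod_binomial_fps_nonpos:
  fixes m c :: "'a \<Rightarrow> real"
  assumes "finite S" "\<And>i. i \<in> S \<Longrightarrow> m i > 0" "(\<Sum>i\<in>S. m i) = 1"
    and "\<And>i. i \<in> S \<Longrightarrow> c i \<ge> 0" and "k \<ge> 1"
  shows "(\<Prod>i\<in>S. binomial_fps (m i) (c i)) $ k \<le> 0"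
  using assms
proof (induction S arbitrary: m c k rule: finite_psubset_induct)
  case (psubset S)
  have "S \<noteq> {}" using psubset.prems(2) by auto
  \<comment> \<open>Minimality of \<open>c p\<close> keeps all differences \<open>c i - c p\<close>
    nonnegative, as the induction hypothesis demands.\<close>
  then obtain p where p: "p \<in> S" "\<And>i. i \<in> S \<Longrightarrow> c p \<le> c i"
    using psubset.hyps by (metis arg_min_if_finite(1) arg_min_least)
  have sum: "(\<Sum>i\<in>S. m i) = m p + (\<Sum>i\<in>S - {p}. m i)"
    using p psubset.hyps by (simp add: sum.remove)
  have nonpos: "(\<Prod>i\<in>S - {p}. binomial_fps (m i) (c i - c p)) $ j \<le> 0" if "j \<ge> 1" for j
  proof (cases "S - {p} = {}")
    \<comment> \<open>With a single factor the remaining product is empty, so equality with 0 occurs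
      here.\<close>
    case True
    show ?thesis unfolding True using that by simp
  next
    case False
    show ?thesis
    proof (rule prod_binomial_fps_sum_less_1(1))
      fix m' :: "'a \<Rightarrow> real" and j' :: nat
      assume "\<And>i. i \<in> S - {p} \<Longrightarrow> m' i > 0" "(\<Sum>i\<in>S - {p}. m' i) = 1" "j' \<ge> 1"
      then show "(\<Prod>i\<in>S - {p}. binomial_fps (m' i) (c i - c p)) $ j' \<le> 0"
        using p by (intro psubset.IH) auto
    next
      show "(\<Sum>i\<in>S - {p}. m i) < 1"
        using sum psubset.prems(1)[OF p(1)] psubset.prems(2) by simp
    qed (use False that p psubset in auto)
  qed
  have "(\<Prod>i\<in>S. binomial_fps (m i) (c i)) $ k
      \<le> (\<Prod>i\<in>S - {p}. binomial_fps (m i) (c i - c p)) $ k"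
    using psubset p nonpos by (intro prod_binomial_fps_shift_min) auto
  also have "\<dots> \<le> 0" using nonpos psubset.prems by blast
  finally show ?case .
qed

lemma prod_binomial_fps_neg_sum_less_1:
  fixes m c :: "'a \<Rightarrow> real"
  assumes "finite S" "\<And>i. i \<in> S \<Longrightarrow> m i > 0" "(\<Sum>i\<in>S. m i) < 1"
    and "\<And>i. i \<in> S \<Longrightarrow> c i \<ge> 0" "i \<in> S" "c i > 0" "k \<ge> 1"
  shows "(\<Prod>i\<in>S. binomial_fps (m i) (c i)) $ k < 0"
proof (rule prod_binomial_fps_sum_less_1(2))
  show "i \<in> S" "c i > 0" by fact+
qed (use assms in \<open>auto intro: prod_binomial_fps_nonpos\<close>)

theorem theorem1:
  fixes n :: nat and \<mu> c :: "nat \<Rightarrow> real" and D :: "nat \<Rightarrow> real"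
  assumes "n \<ge> 1"
    and "\<And>k. k \<in> {1..n} \<Longrightarrow> \<mu> k > 0"
    and "(\<Sum>k=1..n. \<mu> k) \<le> 1"
    and "\<And>j k. 1 \<le> j \<Longrightarrow> j < k \<Longrightarrow> k \<le> n \<Longrightarrow> c j > c k"
    and "c n > 0"
    and "n \<ge> 2 \<or> (n = 1 \<and> \<mu> 1 < 1)"
    and "(\<Prod>j=1..n. binomial_fps (\<mu> j) (c j))
           = 1 - Abs_fps (\<lambda>j. if j = 0 then 0 else D j)"
  shows "\<forall>j\<ge>1. D j > 0"
proof (intro allI impI)
  fix j :: nat assume j: "j \<ge> 1"
  have c_less: "c n < c i" if "i \<in> {1..n} - {n}" for i
    using assms(4)[of i n] that by auto
  then have c_pos: "c i > 0" if "i \<in> {1..n}" for i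
    using assms(5) that by (cases "i = n") (auto intro: less_trans)
  have "(\<Prod>i=1..n. binomial_fps (\<mu> i) (c i)) $ j < 0"
  proof (cases "(\<Sum>k=1..n. \<mu> k) < 1")
    case True
    show ?thesis
      using assms(1,2) True c_pos j
      by (intro prod_binomial_fps_neg_sum_less_1[where i = n]) (auto simp: less_imp_le)
  next
    case False
    then have sum: "(\<Sum>k=1..n. \<mu> k) = 1" using assms(3) by simp
    \<comment> \<open>Sum 1 rules out the alternative \<open>n = 1\<close> with exponent below 1, so
      a factor survives the removal of \<open>n\<close>.\<close>
    then have n: "n \<ge> 2" using assms(6) by auto
    have split: "(\<Sum>k=1..n. \<mu> k) = \<mu> n + (\<Sum>k\<in>{1..n} - {n}. \<mu> k)"
      using assms(1) by (simp add: sum.remove)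
    have neg: "(\<Prod>i\<in>{1..n} - {n}. binomial_fps (\<mu> i) (c i - c n)) $ k < 0" if "k \<ge> 1" for k
    proof (rule prod_binomial_fps_neg_sum_less_1)
      show "(\<Sum>k\<in>{1..n} - {n}. \<mu> k) < 1"
        using split sum assms(1) assms(2)[of n] by simp
      \<comment> \<open>Index 1 witnesses a positive shifted base, which makes the inequality
        strict.\<close>
      show "1 \<in> {1..n} - {n}" "c 1 - c n > 0"
        using n c_less[of 1] by auto
    qed (use assms(2) c_less that in \<open>auto simp: less_imp_le\<close>)
    have "(\<Prod>i=1..n. binomial_fps (\<mu> i) (c i)) $ j
        \<le> (\<Prod>i\<in>{1..n} - {n}. binomial_fps (\<mu> i) (c i - c n)) $ j"
      using assms(1,5) sum neg j
      by (intro prod_binomial_fps_shift_min) (auto simp: less_imp_le)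
    also have "\<dots> < 0" using neg j by blast
    finally show ?thesis .
  qed
  then show "D j > 0"
    using j unfolding assms(7) by simp
qed

end
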